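(* Let $X$ and $Y$ be nonempty finite sets, let $G \subseteq \mathrm{Aut}(X)$ and $K \subseteq \mathrm{Aut}(Y)$ be subgroups, and let $T \colon G \to K$ be a group homomorphism such that $T(G)$ acts transitively on $Y$. Let $\mathcal{F}^T_{\mathrm{lin}}$ be the set of all linear maps $F\colon\mathbb{R}^X\to\mathbb{R}^Y$ such that $(F,T)$ is a GENEO from $(\mathbb{R}^X,G)$ to $(\mathbb{R}^Y,K)$, endowed with the operator norm. Let $\mathcal{O}_1,\dots,\mathcal{O}_k$ be the distinct orbits of $X^Y$ under the action $(g,h)\mapsto g\circ h\circ T(g^{-1})$ of $G$. Then $\mathcal{F}^T_{\mathrm{lin}}$ is compact and coincides with the convex hull of the set $$\left\{\tfrac{1}{|\mathcal{O}_1|}F_{\nu_1},\ldots,\tfrac{1}{|\mathcal{O}_k|}F_{\nu_k},-\tfrac{1}{|\mathcal{O}_1|}F_{\nu_1},\ldots,-\tfrac{1}{|\mathcal{O}_k|}F_{\nu_k}\right\},$$ where $F_{\nu_i}(\varphi)=\sum_{h\in\mathcal{O}_i}\varphi\circ h$ for every $\varphi\in\mathbb{R}^X$.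
   Context: For a finite set $Z$, $\mathbb{R}^Z$ is the space of all functions $Z\to\mathbb{R}$ with the uniform norm $\|\cdot\|_\infty$, and $\mathrm{Aut}(Z)$ is the group of all bijections $Z\to Z$ under composition. $X^Y$ is the (finite) set of all functions $Y\to X$. $(F,T)$, with $F\colon\mathbb{R}^X\to\mathbb{R}^Y$, is a GENEO from $(\mathbb{R}^X,G)$ to $(\mathbb{R}^Y,K)$ if $F(\varphi\circ g)=F(\varphi)\circ T(g)$ for all $\varphi\in\mathbb{R}^X$, $g\in G$, and $\|F(\varphi_1)-F(\varphi_2)\|_\infty\le\|\varphi_1-\varphi_2\|_\infty$ for all $\varphi_1,\varphi_2\in\mathbb{R}^X$. The operator norm is $\|F\|_{\mathrm{op}}:=\sup\{\|F(\varphi)\|_\infty : \varphi\in\mathbb{R}^X,\ \|\varphi\|_\infty=1\}$. Here $\nu_i$ denotes the measure on the power set of $X^Y$ with $\nu_i(\{h\})=1$ if $h\in\mathcal{O}_i$ and $0$ otherwise, and, for a signed measure $\mu$ on the power set of $X^Y$, $F_\mu(\varphi):=\sum_{h\in X^Y}\mu(\{h\})\,(\varphi\circ h)$. *)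

theory Defs
  imports
    "HOL-Analysis.Analysis"
    "HOL-Algebra.Bij"
    "HOL-Algebra.Group_Action"
    "HOL-Library.Function_Algebras"
begin

instantiation "fun" :: (type, real_vector) real_vector
begin

definition scaleR_fun_def: "c *\<^sub>R f = (\<lambda>x. c *\<^sub>R f x)"

instance
  by standard (auto simp: scaleR_fun_def plus_fun_def fun_eq_iff algebra_simps)

end

lemma scaleR_fun_apply [simp]: "(c *\<^sub>R f) x = c *\<^sub>R f x"
  by (simp add: scaleR_fun_def)

text \<open>
  The nonempty finite sets \<open>X\<close> and \<open>Y\<close> are finite types; the space of real functions on \<open>X\<close> is
  \<^typ>\<open>'x \<Rightarrow> real\<close>, and \<open>Aut(X)\<close> is \<^term>\<open>BijGroup (UNIV :: 'x set)\<close>.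
\<close>

definition unorm :: "('z::finite \<Rightarrow> real) \<Rightarrow> real"
  where "unorm \<phi> = (SUP z. \<bar>\<phi> z\<bar>)"

definition op_norm :: "(('x::finite \<Rightarrow> real) \<Rightarrow> ('y::finite \<Rightarrow> real)) \<Rightarrow> real"
  where "op_norm F = Sup {unorm (F \<phi>) | \<phi>. unorm \<phi> = 1}"

text \<open>
  The locale \<^locale>\<open>Metric_space\<close> asks for nonnegativity and symmetry also outside the carrier,
  hence the default value for maps that are not linear.
\<close>

definition op_dist ::
    "(('x::finite \<Rightarrow> real) \<Rightarrow> ('y::finite \<Rightarrow> real)) \<Rightarrow> (('x \<Rightarrow> real) \<Rightarrow> ('y \<Rightarrow> real)) \<Rightarrow> real"
  where "op_dist F H = (if linear F \<and> linear H then op_norm (F - H) else 0)"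

definition op_topology :: "(('x::finite \<Rightarrow> real) \<Rightarrow> ('y::finite \<Rightarrow> real)) topology"
  where "op_topology = Metric_space.mtopology {F. linear F} op_dist"

definition GENEO ::
    "('x::finite \<Rightarrow> 'x) set \<Rightarrow> ('y::finite \<Rightarrow> 'y) set \<Rightarrow> (('x \<Rightarrow> 'x) \<Rightarrow> ('y \<Rightarrow> 'y))
      \<Rightarrow> (('x \<Rightarrow> real) \<Rightarrow> ('y \<Rightarrow> real)) \<Rightarrow> bool"
  where "GENEO G K T F \<longleftrightarrow>
    T \<in> hom (BijGroup UNIV\<lparr>carrier := G\<rparr>) (BijGroup UNIV\<lparr>carrier := K\<rparr>) \<and>
    (\<forall>\<phi>. \<forall>g\<in>G. F (\<phi> \<circ> g) = F \<phi> \<circ> T g) \<and>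
    (\<forall>\<phi>\<^sub>1 \<phi>\<^sub>2. unorm (F \<phi>\<^sub>1 - F \<phi>\<^sub>2) \<le> unorm (\<phi>\<^sub>1 - \<phi>\<^sub>2))"

definition linear_GENEOs ::
    "('x::finite \<Rightarrow> 'x) set \<Rightarrow> ('y::finite \<Rightarrow> 'y) set \<Rightarrow> (('x \<Rightarrow> 'x) \<Rightarrow> ('y \<Rightarrow> 'y))
      \<Rightarrow> (('x \<Rightarrow> real) \<Rightarrow> ('y \<Rightarrow> real)) set"
  where "linear_GENEOs G K T = {F. linear F \<and> GENEO G K T F}"

definition twisted_action ::
    "(('x \<Rightarrow> 'x) \<Rightarrow> ('y \<Rightarrow> 'y)) \<Rightarrow> ('x \<Rightarrow> 'x) \<Rightarrow> ('y \<Rightarrow> 'x) \<Rightarrow> ('y \<Rightarrow> 'x)"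
  where "twisted_action T g h = g \<circ> h \<circ> T (inv\<^bsub>BijGroup UNIV\<^esub> g)"

definition twisted_orbits ::
    "('x \<Rightarrow> 'x) set \<Rightarrow> (('x \<Rightarrow> 'x) \<Rightarrow> ('y \<Rightarrow> 'y)) \<Rightarrow> ('y \<Rightarrow> 'x) set set"
  where "twisted_orbits G T = orbits (BijGroup UNIV\<lparr>carrier := G\<rparr>) UNIV (twisted_action T)"

definition orbit_measure :: "('y \<Rightarrow> 'x) set \<Rightarrow> ('y \<Rightarrow> 'x) measure"
  where "orbit_measure Orb = point_measure UNIV (indicator Orb)"

text \<open>
  A signed measure \<open>\<mu>\<close> on the power set is represented by its real-valued set function; for
  a finite measure \<open>M\<close> this is \<^term>\<open>measure M\<close>.
\<close>

definition F_op ::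
    "(('y::finite \<Rightarrow> 'x::finite) set \<Rightarrow> real) \<Rightarrow> ('x \<Rightarrow> real) \<Rightarrow> ('y \<Rightarrow> real)"
  where "F_op \<mu> \<phi> = (\<Sum>h\<in>UNIV. \<mu> {h} *\<^sub>R (\<phi> \<circ> h))"

lemma measure_orbit_measure:
  fixes Orb :: "('y::finite \<Rightarrow> 'x::finite) set"
  shows "measure (orbit_measure Orb) {h} = (if h \<in> Orb then 1 else 0)"
  by (simp add: orbit_measure_def measure_def emeasure_point_measure_finite indicator_def)

lemma abs_le_unorm: "\<bar>\<phi> z\<bar> \<le> unorm \<phi>"
  unfolding unorm_def by (rule cSUP_upper) auto

lemma unorm_le: "(\<And>z. \<bar>\<phi> z\<bar> \<le> c) \<Longrightarrow> unorm \<phi> \<le> c"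
  unfolding unorm_def by (rule cSUP_least) auto

lemma unorm_nonneg: "0 \<le> unorm \<phi>"
  using abs_le_unorm[of \<phi> undefined] by linarith

lemma unorm_eq_0: "unorm \<phi> = 0 \<longleftrightarrow> \<phi> = 0"
proof
  assume "unorm \<phi> = 0"
  then show "\<phi> = 0" using abs_le_unorm[of \<phi>] by (auto simp: fun_eq_iff)
next
  assume "\<phi> = 0"
  then have "unorm \<phi> \<le> 0" by (intro unorm_le) auto
  then show "unorm \<phi> = 0" using unorm_nonneg[of \<phi>] by linarith
qed

lemma unorm_triangle: "unorm (\<phi> + \<psi>) \<le> unorm \<phi> + unorm \<psi>"
proof (rule unorm_le)
  fix z
  show "\<bar>(\<phi> + \<psi>) z\<bar> \<le> unorm \<phi> + unorm \<psi>"
    using abs_le_unorm[of \<phi> z] abs_le_unorm[of \<psi> z] by (simp add: plus_fun_def)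
qed

lemma unorm_scaleR: "unorm (c *\<^sub>R \<phi>) = \<bar>c\<bar> * unorm \<phi>"
proof -
  have le: "unorm (c *\<^sub>R \<phi>) \<le> \<bar>c\<bar> * unorm \<phi>" for c :: real and \<phi> :: "'a \<Rightarrow> real"
    by (rule unorm_le) (simp add: abs_mult abs_le_unorm mult_left_mono)
  show ?thesis
  proof (cases "c = 0")
    case True
    then have "c *\<^sub>R \<phi> = 0" by simp
    then have "unorm (c *\<^sub>R \<phi>) = 0" by (simp only: unorm_eq_0)
    then show ?thesis using True by simp
  next
    case False
    have "unorm \<phi> = unorm (inverse c *\<^sub>R (c *\<^sub>R \<phi>))" using False by simp
    also have "\<dots> \<le> \<bar>inverse c\<bar> * unorm (c *\<^sub>R \<phi>)" by (rule le)
    finally have "\<bar>c\<bar> * unorm \<phi> \<le> unorm (c *\<^sub>R \<phi>)"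
      using False by (simp add: field_simps)
    then show ?thesis using le[of c \<phi>] by linarith
  qed
qed

lemma sum_fun_apply: "(\<Sum>i\<in>I. f i) x = (\<Sum>i\<in>I. f i x)"
  by (induction I rule: infinite_finite_induct) (auto simp: plus_fun_def)

lemma linear_unorm_bounded:
  fixes F :: "('x::finite \<Rightarrow> real) \<Rightarrow> ('y::finite \<Rightarrow> real)"
  assumes "linear F"
  obtains B where "\<And>\<phi>. unorm (F \<phi>) \<le> B * unorm \<phi>"
proof
  fix \<phi> :: "'x \<Rightarrow> real"
  let ?e = "\<lambda>x z. if z = x then 1 else 0 :: real"
  have "\<phi> = (\<Sum>x\<in>UNIV. \<phi> x *\<^sub>R ?e x)"
    by (auto simp: fun_eq_iff sum_fun_apply if_distrib cong: if_cong)
  then have "F \<phi> = F (\<Sum>x\<in>UNIV. \<phi> x *\<^sub>R ?e x)" by (rule arg_cong)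
  also have "\<dots> = (\<Sum>x\<in>UNIV. \<phi> x *\<^sub>R F (?e x))"
    by (simp only: linear_sum[OF assms] linear_scale[OF assms])
  finally have eq: "F \<phi> = (\<Sum>x\<in>UNIV. \<phi> x *\<^sub>R F (?e x))" .
  show "unorm (F \<phi>) \<le> (\<Sum>x\<in>UNIV. unorm (F (?e x))) * unorm \<phi>"
  proof (rule unorm_le)
    fix y
    have "\<bar>F \<phi> y\<bar> = \<bar>\<Sum>x\<in>UNIV. \<phi> x * F (?e x) y\<bar>"
      by (subst eq) (simp add: sum_fun_apply)
    also have "\<dots> \<le> (\<Sum>x\<in>UNIV. \<bar>\<phi> x * F (?e x) y\<bar>)" by (rule sum_abs)
    also have "\<dots> \<le> (\<Sum>x\<in>UNIV. unorm \<phi> * unorm (F (?e x)))"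
      by (intro sum_mono) (simp add: abs_mult mult_mono abs_le_unorm unorm_nonneg)
    also have "\<dots> = (\<Sum>x\<in>UNIV. unorm (F (?e x))) * unorm \<phi>"
      by (simp add: sum_distrib_left mult.commute)
    finally show "\<bar>F \<phi> y\<bar> \<le> (\<Sum>x\<in>UNIV. unorm (F (?e x))) * unorm \<phi>" .
  qed
qed

lemma unorm_le_op_norm:
  assumes "linear F" "unorm \<phi> = 1"
  shows "unorm (F \<phi>) \<le> op_norm F"
proof -
  obtain B where B: "\<And>\<phi>. unorm (F \<phi>) \<le> B * unorm \<phi>"
    using linear_unorm_bounded[OF assms(1)] by blast
  have "unorm (F \<phi>) \<le> B" if "unorm \<phi> = 1" for \<phi>
    using B[of \<phi>] that by simp
  then have "bdd_above {unorm (F \<phi>) | \<phi>. unorm \<phi> = 1}"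
    by (intro bdd_aboveI[of _ B]) auto
  then show ?thesis
    unfolding op_norm_def using assms(2) by (intro cSup_upper) auto
qed

lemma unorm_const_1: "unorm (\<lambda>_. 1) = 1"
  by (simp add: unorm_def)

lemma op_norm_le:
  assumes "\<And>\<phi>. unorm \<phi> = 1 \<Longrightarrow> unorm (F \<phi>) \<le> c"
  shows "op_norm F \<le> c"
  unfolding op_norm_def using assms unorm_const_1 by (intro cSup_least) auto

lemma op_norm_nonneg: "linear F \<Longrightarrow> 0 \<le> op_norm F"
  using unorm_le_op_norm[OF _ unorm_const_1] unorm_nonneg by (rule order_trans[rotated])

lemma op_norm_eq_0:
  assumes "linear F"
  shows "op_norm F = 0 \<longleftrightarrow> F = 0"
proof
  assume z: "op_norm F = 0"
  show "F = 0"
  proof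
    fix \<phi>
    show "F \<phi> = 0 \<phi>"
    proof (cases "\<phi> = 0")
      case True
      then show ?thesis using linear_0[OF assms] by simp
    next
      case False
      then have nz: "unorm \<phi> \<noteq> 0" by (simp add: unorm_eq_0)
      have "unorm (inverse (unorm \<phi>) *\<^sub>R \<phi>) = 1"
        using nz unorm_nonneg[of \<phi>] by (simp add: unorm_scaleR)
      then have "unorm (F (inverse (unorm \<phi>) *\<^sub>R \<phi>)) \<le> 0"
        using unorm_le_op_norm[OF assms] z by metis
      then have "unorm (F (inverse (unorm \<phi>) *\<^sub>R \<phi>)) = 0"
        using unorm_nonneg order_antisym by blast
      then have "F (inverse (unorm \<phi>) *\<^sub>R \<phi>) = 0" by (simp only: unorm_eq_0)
      then have "inverse (unorm \<phi>) *\<^sub>R F \<phi> = 0" by (simp only: linear_scale[OF assms])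
      then show ?thesis using nz by (simp add: fun_eq_iff)
    qed
  qed
next
  assume F: "F = 0"
  then have "unorm (F \<phi>) = 0" for \<phi> by (simp add: unorm_eq_0)
  then have "op_norm F \<le> 0" by (intro op_norm_le) auto
  then show "op_norm F = 0" using op_norm_nonneg[OF assms] by linarith
qed

lemma linear_fun_diff: "linear F \<Longrightarrow> linear H \<Longrightarrow> linear (F - H)"
  using linear_compose_sub[of F H] by (simp add: fun_diff_def)

theorem Metric_space_op_dist:
  "Metric_space {F :: ('x::finite \<Rightarrow> real) \<Rightarrow> ('y::finite \<Rightarrow> real). linear F} op_dist"
proof
  fix F H :: "('x \<Rightarrow> real) \<Rightarrow> ('y \<Rightarrow> real)"
  show "0 \<le> op_dist F H"
    by (simp add: op_dist_def op_norm_nonneg linear_fun_diff)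
  have "unorm ((F - H) \<phi>) = unorm ((H - F) \<phi>)" for \<phi>
    by (simp add: unorm_def abs_minus_commute)
  then show "op_dist F H = op_dist H F"
    by (simp add: op_dist_def op_norm_def)
next
  fix F H :: "('x \<Rightarrow> real) \<Rightarrow> ('y \<Rightarrow> real)"
  assume "F \<in> {F. linear F}" "H \<in> {F. linear F}"
  then show "op_dist F H = 0 \<longleftrightarrow> F = H"
    by (simp add: op_dist_def op_norm_eq_0 linear_fun_diff)
next
  fix F H J :: "('x \<Rightarrow> real) \<Rightarrow> ('y \<Rightarrow> real)"
  assume lin: "F \<in> {F. linear F}" "H \<in> {F. linear F}" "J \<in> {F. linear F}"
  have "op_norm (F - J) \<le> op_norm (F - H) + op_norm (H - J)"
  proof (rule op_norm_le)
    fix \<phi> :: "'x \<Rightarrow> real"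
    assume 1: "unorm \<phi> = 1"
    have "(F - J) \<phi> = (F - H) \<phi> + (H - J) \<phi>" by simp
    then have "unorm ((F - J) \<phi>) \<le> unorm ((F - H) \<phi>) + unorm ((H - J) \<phi>)"
      using unorm_triangle by metis
    then show "unorm ((F - J) \<phi>) \<le> op_norm (F - H) + op_norm (H - J)"
      using unorm_le_op_norm[of "F - H" \<phi>] unorm_le_op_norm[of "H - J" \<phi>] lin 1
      by (fastforce simp: linear_fun_diff)
  qed
  then show "op_dist F J \<le> op_dist F H + op_dist H J"
    using lin by (simp add: op_dist_def)
qed

end

theory Submission
  imports Defs
begin

text \<open>
  A linear map \<open>F\<close> is given by a matrix \<open>a\<close>; equivariance means \<open>a (T g y) (g x) = a y x\<close>, and
  nonexpansiveness means that the rows have \<open>\<ell>\<^sup>1\<close>-norm at most 1. The positive and negative parts of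
  \<open>a\<close> are again equivariant, so by transitivity each of them has constant row sums \<open>P\<close> and \<open>N\<close>,
  with \<open>P + N \<le> 1\<close>. After scaling to row sums 1, such a part is the average of the maps
  \<open>\<phi> \<mapsto> \<phi> \<circ> h\<close> with respect to the product weight \<open>w h = (\<Prod>y. a y (h y))\<close>. By equivariance \<open>w\<close> is
  constant on orbits, so this average is a convex combination of the orbit averages. Compactness
  holds because the convex hull is the continuous image of the convex hull of finitely many
  matrices.
\<close>

section \<open>Kernels of linear operators\<close>

text \<open>Matrices with rows indexed by \<open>'y\<close> are curried functions here, which suits
  row sums and products over rows; the type \<open>real ^ 'x ^ 'y\<close> serves for the topological
  arguments.\<close>

definition kernel_op :: "('y \<Rightarrow> 'x \<Rightarrow> real) \<Rightarrow> ('x::finite \<Rightarrow> real) \<Rightarrow> ('y::finite \<Rightarrow> real)"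
  where "kernel_op a \<phi> y = (\<Sum>x\<in>UNIV. a y x * \<phi> x)"

definition kernel_of :: "(('x::finite \<Rightarrow> real) \<Rightarrow> ('y::finite \<Rightarrow> real)) \<Rightarrow> 'y \<Rightarrow> 'x \<Rightarrow> real"
  where "kernel_of F y x = F (indicator {x}) y"

lemma linear_kernel_op: "linear (kernel_op a)"
  by (rule linearI)
    (auto simp: kernel_op_def fun_eq_iff algebra_simps sum.distrib sum_distrib_left)

lemma kernel_op_kernel_of:
  fixes F :: "('x::finite \<Rightarrow> real) \<Rightarrow> ('y::finite \<Rightarrow> real)"
  assumes "linear F"
  shows "kernel_op (kernel_of F) = F"
proof (intro ext)
  fix \<phi> :: "'x \<Rightarrow> real" and y
  have "\<phi> = (\<Sum>x\<in>UNIV. \<phi> x *\<^sub>R indicator {x})"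
    by (auto simp: fun_eq_iff sum_fun_apply indicator_def if_distrib cong: if_cong)
  then have "F \<phi> = F (\<Sum>x\<in>UNIV. \<phi> x *\<^sub>R indicator {x})" by (rule arg_cong)
  also have "\<dots> = (\<Sum>x\<in>UNIV. \<phi> x *\<^sub>R F (indicator {x}))"
    by (simp only: linear_sum[OF assms] linear_scale[OF assms])
  finally show "kernel_op (kernel_of F) \<phi> y = F \<phi> y"
    by (simp add: kernel_op_def kernel_of_def sum_fun_apply mult.commute)
qed

text \<open>Testing \<open>F\<close> on the signs of row \<open>y\<close>, a function of uniform
  norm at most 1, produces the absolute row sum as the value at \<open>y\<close>.\<close>

lemma sum_abs_kernel_of_le_1:
  fixes F :: "('x::finite \<Rightarrow> real) \<Rightarrow> ('y::finite \<Rightarrow> real)"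
  assumes "linear F" and nonexp: "\<And>\<phi>. unorm (F \<phi>) \<le> unorm \<phi>"
  shows "(\<Sum>x\<in>UNIV. \<bar>kernel_of F y x\<bar>) \<le> 1"
proof -
  let ?\<phi> = "\<lambda>x. sgn (kernel_of F y x)"
  have "(\<Sum>x\<in>UNIV. \<bar>kernel_of F y x\<bar>) = kernel_op (kernel_of F) ?\<phi> y"
    by (simp add: kernel_op_def abs_sgn)
  also have "\<dots> = F ?\<phi> y"
    by (simp only: kernel_op_kernel_of[OF assms(1)])
  also have "\<dots> \<le> unorm (F ?\<phi>)"
    using abs_le_unorm[of "F ?\<phi>" y] by linarith
  also have "\<dots> \<le> unorm ?\<phi>" by (rule nonexp)
  also have "\<dots> \<le> 1" by (rule unorm_le) (simp add: abs_sgn_eq)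
  finally show ?thesis .
qed

text \<open>
  A stochastic kernel is the mean of the deterministic maps \<open>h\<close> whose values \<open>h z\<close> are drawn
  independently from the rows.
\<close>

lemma sum_prod_kernel:
  fixes a :: "'y::finite \<Rightarrow> 'x::finite \<Rightarrow> real"
  assumes "\<And>y. (\<Sum>x\<in>UNIV. a y x) = 1"
  shows "(\<Sum>h\<in>UNIV. (\<Prod>z\<in>UNIV. a z (h z)) * \<phi> (h y)) = kernel_op a \<phi> y"
proof -
  \<comment> \<open>The value \<open>\<phi> (h y)\<close> is absorbed into the factor at
    \<open>z = y\<close>, so that the sum over all \<open>h\<close> factors into a product of row
    sums; every row other than \<open>y\<close> then contributes 1.\<close>
  have "(\<Sum>h\<in>UNIV. (\<Prod>z\<in>UNIV. a z (h z)) * \<phi> (h y))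
      = (\<Sum>h\<in>UNIV. \<Prod>z\<in>UNIV. a z (h z) * (if z = y then \<phi> (h z) else 1))"
    by (simp add: prod.distrib)
  also have "\<dots> = (\<Prod>z\<in>UNIV. \<Sum>x\<in>UNIV. a z x * (if z = y then \<phi> x else 1))"
    by (subst prod_sum_PiE) (auto simp: PiE_UNIV_domain)
  also have "\<dots> = (\<Prod>z\<in>UNIV. if z = y then kernel_op a \<phi> y else 1)"
    by (rule prod.cong) (auto simp: kernel_op_def assms)
  also have "\<dots> = kernel_op a \<phi> y"
    by simp
  finally show ?thesis .
qed

section \<open>Matrices as a continuous parametrisation of linear maps, and compactness\<close>

lemma op_norm_kernel_op_le:
  fixes A :: "real ^ 'x::finite ^ 'y::finite"
  shows "op_norm (kernel_op (\<lambda>y x. A $ y $ x)) \<le> real CARD('x) * norm A"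
proof (rule op_norm_le, rule unorm_le)
  fix \<phi> :: "'x \<Rightarrow> real" and y
  assume "unorm \<phi> = 1"
  have "\<bar>A $ y $ x * \<phi> x\<bar> \<le> norm A" for x
  proof -
    have "\<bar>A $ y $ x\<bar> \<le> norm A"
      by (metis Finite_Cartesian_Product.norm_nth_le order_trans real_norm_def)
    moreover have "\<bar>\<phi> x\<bar> \<le> 1"
      using abs_le_unorm[of \<phi> x] \<open>unorm \<phi> = 1\<close> by simp
    ultimately have "\<bar>A $ y $ x\<bar> * \<bar>\<phi> x\<bar> \<le> norm A * 1"
      by (intro mult_mono) auto
    then show ?thesis by (simp add: abs_mult)
  qed
  then have "(\<Sum>x\<in>UNIV. \<bar>A $ y $ x * \<phi> x\<bar>) \<le> (\<Sum>x\<in>(UNIV::'x set). norm A)"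
    by (intro sum_mono) auto
  then show "\<bar>kernel_op (\<lambda>y x. A $ y $ x) \<phi> y\<bar> \<le> real CARD('x) * norm A"
    unfolding kernel_op_def by (intro order_trans[OF sum_abs]) simp
qed

text \<open>The entrywise bound \<open>op_norm_kernel_op_le\<close>, applied to
  \<open>A - B\<close>, makes the parametrisation Lipschitz with constant \<open>CARD('x)\<close>;
  hence the radius of the ball chosen below.\<close>

lemma continuous_map_kernel_op:
  "continuous_map euclidean op_topology
     (\<lambda>A :: real ^ 'x::finite ^ 'y::finite. kernel_op (\<lambda>y x. A $ y $ x))"
proof -
  interpret Metric_space "{F :: ('x \<Rightarrow> real) \<Rightarrow> ('y \<Rightarrow> real). linear F}" op_dist
    by (rule Metric_space_op_dist)
  have dist: "op_dist (kernel_op (\<lambda>y x. A $ y $ x)) (kernel_op (\<lambda>y x. B $ y $ x))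
      \<le> real CARD('x) * dist A B" for A B :: "real ^ 'x ^ 'y"
  proof -
    have "kernel_op (\<lambda>y x. A $ y $ x) - kernel_op (\<lambda>y x. B $ y $ x)
        = kernel_op (\<lambda>y x. (A - B) $ y $ x)"
      by (auto simp: fun_eq_iff kernel_op_def sum_subtractf algebra_simps)
    then show ?thesis
      using op_norm_kernel_op_le[of "A - B"] by (simp add: op_dist_def linear_kernel_op dist_norm)
  qed
  have "\<exists>U. openin euclidean U \<and> A \<in> U \<and> (\<forall>B\<in>U. kernel_op (\<lambda>y x. B $ y $ x)
      \<in> mball (kernel_op (\<lambda>y x. A $ y $ x)) \<epsilon>)" if "0 < \<epsilon>" for A :: "real ^ 'x ^ 'y" and \<epsilon>
  proof (intro exI conjI ballI)
    show "openin euclidean (ball A (\<epsilon> / real CARD('x)))" by simp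
    show "A \<in> ball A (\<epsilon> / real CARD('x))" using that by simp
    fix B assume "B \<in> ball A (\<epsilon> / real CARD('x))"
    then have "real CARD('x) * dist A B < \<epsilon>" by (simp add: field_simps)
    then show "kernel_op (\<lambda>y x. B $ y $ x) \<in> mball (kernel_op (\<lambda>y x. A $ y $ x)) \<epsilon>"
      using dist[of A B] by (simp add: linear_kernel_op)
  qed
  then show ?thesis
    unfolding op_topology_def continuous_map_to_metric by blast
qed

lemma compactin_op_topology_convex_hull:
  fixes S :: "(('x::finite \<Rightarrow> real) \<Rightarrow> ('y::finite \<Rightarrow> real)) set"
  assumes "finite S" and lin: "\<And>F. F \<in> S \<Longrightarrow> linear F"
  shows "compactin op_topology (convex hull S)"
proof -
  let ?\<Phi> = "\<lambda>A :: real ^ 'x ^ 'y. kernel_op (\<lambda>y x. A $ y $ x)"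
  let ?M = "(\<lambda>F. \<chi> y x. kernel_of F y x) ` S"
  have "linear ?\<Phi>"
    by (rule linearI)
      (auto simp: kernel_op_def fun_eq_iff algebra_simps sum.distrib sum_distrib_left)
  then have "?\<Phi> ` (convex hull ?M) = convex hull (?\<Phi> ` ?M)"
    by (rule convex_hull_linear_image)
  \<comment> \<open>The members of \<open>S\<close> are linear, hence recovered from their
    matrices.\<close>
  also have "?\<Phi> ` ?M = S"
    using lin by (simp add: image_image vec_lambda_inverse kernel_op_kernel_of cong: image_cong)
  finally have hull: "?\<Phi> ` (convex hull ?M) = convex hull S" .
  have "compactin euclidean (convex hull ?M)"
    using finite_imp_compact_convex_hull[of ?M] assms(1) by simp
  then show ?thesis
    using image_compactin[OF _ continuous_map_kernel_op] hull by metis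
qed

section \<open>Orbit averages\<close>

definition orbit_average ::
    "('y::finite \<Rightarrow> 'x::finite) set \<Rightarrow> ('x \<Rightarrow> real) \<Rightarrow> ('y \<Rightarrow> real)"
  where "orbit_average Orb = (1 / real (card Orb)) *\<^sub>R F_op (measure (orbit_measure Orb))"

text \<open>This reduces the measure to a plain finite sum and yields the last conjunct of the final
  theorem.\<close>

lemma F_op_orbit_measure:
  fixes Orb :: "('y::finite \<Rightarrow> 'x::finite) set"
  shows "F_op (measure (orbit_measure Orb)) \<phi> = (\<Sum>h\<in>Orb. \<phi> \<circ> h)"
proof
  fix y
  have "F_op (measure (orbit_measure Orb)) \<phi> y
      = (\<Sum>h\<in>UNIV. if h \<in> Orb then \<phi> (h y) else 0)"
    by (simp add: F_op_def sum_fun_apply measure_orbit_measure if_distrib[of "\<lambda>c. c * _"] cong: if_cong)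
  also have "\<dots> = (\<Sum>h\<in>Orb. \<phi> \<circ> h) y"
    by (simp add: sum_fun_apply sum.inter_restrict[symmetric, where A = UNIV, simplified])
  finally show "F_op (measure (orbit_measure Orb)) \<phi> y = (\<Sum>h\<in>Orb. \<phi> \<circ> h) y" .
qed

lemma orbit_average_apply:
  "orbit_average Orb \<phi> y = (\<Sum>h\<in>Orb. \<phi> (h y)) / real (card Orb)"
  by (simp add: orbit_average_def F_op_orbit_measure sum_fun_apply)

lemma linear_orbit_average: "linear (orbit_average Orb)"
  by (rule linearI)
    (auto simp: fun_eq_iff orbit_average_apply sum.distrib add_divide_distrib
      sum_distrib_left[symmetric])

lemma unorm_orbit_average_le: "unorm (orbit_average Orb \<phi>) \<le> unorm \<phi>"
proof (rule unorm_le)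
  fix y
  have "\<bar>\<Sum>h\<in>Orb. \<phi> (h y)\<bar> \<le> real (card Orb) * unorm \<phi>"
    by (intro order_trans[OF sum_abs] sum_bounded_above) (rule abs_le_unorm)
  \<comment> \<open>The empty set is separate because its cardinality cannot be cancelled; its
    average is 0, by the convention for division by 0.\<close>
  then show "\<bar>orbit_average Orb \<phi> y\<bar> \<le> unorm \<phi>"
    by (cases "Orb = {}")
      (auto simp: orbit_average_apply unorm_nonneg abs_divide pos_divide_le_eq card_gt_0_iff mult.commute)
qed

section \<open>The group of all bijections of a type\<close>

lemma BijGroup_UNIV_carrier [simp]: "carrier (BijGroup UNIV) = {f. bij f}"
  by (simp add: BijGroup_def Bij_def extensional_def)

lemma BijGroup_UNIV_mult [simp]:
  "bij f \<Longrightarrow> bij g \<Longrightarrow> f \<otimes>\<^bsub>BijGroup UNIV\<^esub> g = f \<circ> g"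
  by (simp add: BijGroup_def Bij_def extensional_def compose_def comp_def restrict_def)

lemma BijGroup_UNIV_one [simp]: "\<one>\<^bsub>BijGroup UNIV\<^esub> = id"
  by (simp add: BijGroup_def restrict_def id_def)

lemma BijGroup_UNIV_inv:
  assumes "bij f"
  shows "inv\<^bsub>BijGroup UNIV\<^esub> f = inv_into UNIV f"
proof (rule group.inv_equality[OF group_BijGroup])
  show "inv_into UNIV f \<otimes>\<^bsub>BijGroup UNIV\<^esub> f = \<one>\<^bsub>BijGroup UNIV\<^esub>"
    using assms by (simp add: bij_imp_bij_inv bij_is_inj)
qed (use assms in \<open>simp_all add: bij_imp_bij_inv\<close>)

section \<open>Convex combinations of orbit averages\<close>

locale twisted =
  fixes G :: "('x::finite \<Rightarrow> 'x) set" and K :: "('y::finite \<Rightarrow> 'y) set"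
    and T :: "('x \<Rightarrow> 'x) \<Rightarrow> ('y \<Rightarrow> 'y)"
  assumes subgroup_G: "subgroup G (BijGroup UNIV)"
    and subgroup_K: "subgroup K (BijGroup UNIV)"
    and hom_T: "T \<in> hom (BijGroup UNIV\<lparr>carrier := G\<rparr>) (BijGroup UNIV\<lparr>carrier := K\<rparr>)"
begin

section \<open>The homomorphism, the twisted action and its orbits\<close>

lemma bij_G: "g \<in> G \<Longrightarrow> bij g"
  using subgroup.subset[OF subgroup_G] by auto

lemma inv_G: "g \<in> G \<Longrightarrow> inv_into UNIV g \<in> G"
  using subgroup.m_inv_closed[OF subgroup_G] bij_G BijGroup_UNIV_inv by metis

lemma comp_G: "g \<in> G \<Longrightarrow> g' \<in> G \<Longrightarrow> g \<circ> g' \<in> G"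
  using subgroup.m_closed[OF subgroup_G] bij_G BijGroup_UNIV_mult by metis

lemma bij_T: "g \<in> G \<Longrightarrow> bij (T g)"
  using hom_T subgroup.subset[OF subgroup_K] by (auto simp: hom_def)

lemma T_comp: "g \<in> G \<Longrightarrow> g' \<in> G \<Longrightarrow> T (g \<circ> g') = T g \<circ> T g'"
  using hom_T by (simp add: hom_def bij_G bij_T)

text \<open>\<open>T id\<close> is an idempotent bijection, hence the identity.\<close>

lemma T_id: "T id = id"
proof -
  have "id \<in> G" using subgroup.one_closed[OF subgroup_G] by simp
  then have "bij (T id)" "T id \<circ> T id = T id"
    using T_comp[of id id] bij_T by auto
  then show ?thesis by (metis bij_is_inj fun.inj_map_strong inv_o_cancel comp_assoc id_comp)
qed

lemma T_inv:
  assumes "g \<in> G"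
  shows "T (inv_into UNIV g) = inv_into UNIV (T g)"
proof (rule inv_unique_comp[symmetric])
  show "T g \<circ> T (inv_into UNIV g) = id"
    using T_comp[OF assms inv_G[OF assms]] bij_G[OF assms] T_id
    by (simp add: bij_is_surj surj_iff[THEN iffD1])
  show "T (inv_into UNIV g) \<circ> T g = id"
    using T_comp[OF inv_G[OF assms] assms] bij_G[OF assms] T_id
    by (simp add: bij_is_inj)
qed

text \<open>In this form the action moves the graph of \<open>h\<close> by \<open>T g\<close> on
  arguments and \<open>g\<close> on values: the new function sends \<open>T g z\<close> to
  \<open>g (h z)\<close>. The equivariance computations below rest on this.\<close>

lemma twisted_action_eq: "g \<in> G \<Longrightarrow> twisted_action T g h = g \<circ> h \<circ> inv_into UNIV (T g)"
  by (simp add: twisted_action_def BijGroup_UNIV_inv bij_G T_inv)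

lemma twisted_action_comp:
  assumes "g \<in> G" "g' \<in> G"
  shows "twisted_action T (g \<circ> g') h = twisted_action T g (twisted_action T g' h)"
  using assms by (simp add: twisted_action_eq comp_G T_comp o_inv_distrib bij_T comp_assoc)

lemma twisted_action_inv:
  assumes "g \<in> G"
  shows "twisted_action T (inv_into UNIV g) (twisted_action T g h) = h"
    and "twisted_action T g (twisted_action T (inv_into UNIV g) h) = h"
proof -
  have T: "inj (T g)" "surj (T g)" and g: "inj g" "surj g"
    using bij_T bij_G assms by (auto simp: bij_is_inj bij_is_surj)
  show "twisted_action T (inv_into UNIV g) (twisted_action T g h) = h"
    and "twisted_action T g (twisted_action T (inv_into UNIV g) h) = h"
    using T g bij_T[OF assms] assms
    by (auto simp: fun_eq_iff twisted_action_eq inv_G T_inv inv_inv_eq surj_f_inv_f)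
qed

lemma bij_twisted_action: "g \<in> G \<Longrightarrow> bij (twisted_action T g)"
  by (rule o_bij[of "twisted_action T (inv_into UNIV g)"]) (auto simp: fun_eq_iff twisted_action_inv)

sublocale act: group_action "BijGroup UNIV\<lparr>carrier := G\<rparr>" "UNIV :: ('y \<Rightarrow> 'x) set"
  "twisted_action T"
proof (intro group_action.intro group_hom.intro group_hom_axioms.intro)
  show "group (BijGroup UNIV\<lparr>carrier := G\<rparr>)"
    by (rule subgroup.subgroup_is_group[OF subgroup_G group_BijGroup])
  show "group (BijGroup (UNIV :: ('y \<Rightarrow> 'x) set))"
    by (rule group_BijGroup)
qed (auto simp: hom_def bij_twisted_action bij_G twisted_action_comp fun_eq_iff)

abbreviation orb :: "('y \<Rightarrow> 'x) \<Rightarrow> ('y \<Rightarrow> 'x) set"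
  where "orb \<equiv> orbit (BijGroup UNIV\<lparr>carrier := G\<rparr>) (twisted_action T)"

lemma orb_eqI: "k \<in> orb h \<Longrightarrow> orb k = orb h"
  using act.orbit_trans act.orbit_sym by blast

lemma twisted_action_image_orbit:
  assumes "g \<in> G" "Orb \<in> twisted_orbits G T"
  shows "twisted_action T g ` Orb = Orb"
proof -
  obtain h where Orb: "Orb = orb h"
    using assms(2) by (auto simp: twisted_orbits_def orbits_def)
  \<comment> \<open>Proved for every group element, since the reverse inclusion applies it to the
    inverse of \<open>g\<close>.\<close>
  have sub: "twisted_action T g' ` Orb \<subseteq> Orb" if "g' \<in> G" for g'
  proof
    fix k assume "k \<in> twisted_action T g' ` Orb"
    then obtain l where "l \<in> orb h" "k = twisted_action T g' l"
      unfolding Orb by blast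
    moreover from this have "k \<in> orb l"
      using that by (auto simp: orbit_def)
    ultimately show "k \<in> Orb" unfolding Orb using act.orbit_trans by blast
  qed
  moreover have "Orb \<subseteq> twisted_action T g ` Orb"
  proof
    fix k assume "k \<in> Orb"
    then have "twisted_action T (inv_into UNIV g) k \<in> Orb"
      using sub[OF inv_G[OF assms(1)]] by auto
    then show "k \<in> twisted_action T g ` Orb"
      using twisted_action_inv(2)[OF assms(1), of k] by (metis imageI)
  qed
  ultimately show ?thesis using assms(1) by blast
qed

text \<open>Acting by \<open>g\<close> permutes the orbit, and the moved function sends
  \<open>T g y\<close> to \<open>g (h y)\<close>, so reindexing gives equivariance. Nonexpansiveness
  follows from the norm bound by linearity.\<close>

lemma orbit_average_GENEO:
  assumes "Orb \<in> twisted_orbits G T"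
  shows "orbit_average Orb \<in> linear_GENEOs G K T"
proof -
  have "orbit_average Orb (\<phi> \<circ> g) = orbit_average Orb \<phi> \<circ> T g" if g: "g \<in> G" for \<phi> g
  proof
    fix y
    have "(\<Sum>h\<in>Orb. \<phi> (h (T g y))) = (\<Sum>h\<in>twisted_action T g ` Orb. \<phi> (h (T g y)))"
      using twisted_action_image_orbit[OF g assms] by simp
    also have "\<dots> = (\<Sum>h\<in>Orb. \<phi> (twisted_action T g h (T g y)))"
      using bij_is_inj[OF bij_twisted_action[OF g]]
      by (subst sum.reindex) (auto intro: inj_on_subset)
    also have "\<dots> = (\<Sum>h\<in>Orb. \<phi> (g (h y)))"
      using bij_is_inj[OF bij_T[OF g]] by (simp add: twisted_action_eq g)
    finally show "orbit_average Orb (\<phi> \<circ> g) y = (orbit_average Orb \<phi> \<circ> T g) y"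
      by (simp add: orbit_average_apply)
  qed
  moreover have "unorm (orbit_average Orb \<phi> - orbit_average Orb \<psi>) \<le> unorm (\<phi> - \<psi>)" for \<phi> \<psi>
    using unorm_orbit_average_le[of Orb "\<phi> - \<psi>"]
    by (simp only: linear_diff[OF linear_orbit_average])
  ultimately show ?thesis
    using hom_T by (simp add: linear_GENEOs_def GENEO_def linear_orbit_average)
qed

text \<open>For linear \<open>F\<close>, nonexpansiveness is a norm bound: compare with the zero
  function in one direction, apply the bound to a difference in the other.\<close>

lemma linear_GENEOs_iff:
  "F \<in> linear_GENEOs G K T \<longleftrightarrow> linear F \<and>
    (\<forall>\<phi>. \<forall>g\<in>G. F (\<phi> \<circ> g) = F \<phi> \<circ> T g) \<and> (\<forall>\<phi>. unorm (F \<phi>) \<le> unorm \<phi>)"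
proof -
  have "(\<forall>\<phi> \<psi>. unorm (F \<phi> - F \<psi>) \<le> unorm (\<phi> - \<psi>)) \<longleftrightarrow> (\<forall>\<phi>. unorm (F \<phi>) \<le> unorm \<phi>)"
    if "linear F"
    by (metis linear_diff[OF that] linear_0[OF that] diff_zero)
  then show ?thesis
    using hom_T by (auto simp: linear_GENEOs_def GENEO_def)
qed

lemma uminus_linear_GENEO:
  assumes "F \<in> linear_GENEOs G K T"
  shows "- F \<in> linear_GENEOs G K T"
proof -
  have "unorm (- \<psi>) = unorm \<psi>" for \<psi> :: "'y \<Rightarrow> real"
    by (simp add: unorm_def)
  then show ?thesis
    using assms linear_compose_neg[of F]
    by (auto simp: linear_GENEOs_iff fun_eq_iff fun_Compl_def)
qed

lemma convex_linear_GENEOs: "convex (linear_GENEOs G K T)"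
proof (rule convexI)
  fix F H and u v :: real
  assume F: "F \<in> linear_GENEOs G K T" and H: "H \<in> linear_GENEOs G K T"
    and uv: "0 \<le> u" "0 \<le> v" "u + v = 1"
  have "linear (\<lambda>\<phi>. u *\<^sub>R F \<phi> + v *\<^sub>R H \<phi>)"
    using F H by (intro linear_compose_add linear_compose_scale_right) (auto simp: linear_GENEOs_iff)
  then have "linear (u *\<^sub>R F + v *\<^sub>R H)"
    by (simp add: plus_fun_def scaleR_fun_def)
  moreover have "unorm ((u *\<^sub>R F + v *\<^sub>R H) \<phi>) \<le> unorm \<phi>" for \<phi>
  proof -
    have "unorm ((u *\<^sub>R F + v *\<^sub>R H) \<phi>) \<le> u * unorm (F \<phi>) + v * unorm (H \<phi>)"
      using unorm_triangle[of "u *\<^sub>R F \<phi>" "v *\<^sub>R H \<phi>"] uv by (simp add: unorm_scaleR)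
    also have "\<dots> \<le> u * unorm \<phi> + v * unorm \<phi>"
      using F H uv by (intro add_mono mult_left_mono) (auto simp: linear_GENEOs_iff)
    also have "\<dots> = unorm \<phi>"
      using uv by (simp flip: distrib_right)
    finally show ?thesis .
  qed
  moreover have "(u *\<^sub>R F + v *\<^sub>R H) (\<phi> \<circ> g) = (u *\<^sub>R F + v *\<^sub>R H) \<phi> \<circ> T g" if "g \<in> G" for \<phi> g
    using F H that by (simp add: linear_GENEOs_iff fun_eq_iff)
  ultimately show "u *\<^sub>R F + v *\<^sub>R H \<in> linear_GENEOs G K T"
    by (simp add: linear_GENEOs_iff)
qed

text \<open>Composing the indicator of \<open>{g x}\<close> with the injective \<open>g\<close>
  gives the indicator of \<open>{x}\<close>, so equivariance of \<open>F\<close> on indicators is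
  invariance of its matrix.\<close>

lemma kernel_of_equivariant:
  assumes F: "F \<in> linear_GENEOs G K T" and g: "g \<in> G"
  shows "kernel_of F (T g y) (g x) = kernel_of F y x"
proof -
  have "indicator {g x} \<circ> g = (indicator {x} :: 'x \<Rightarrow> real)"
    using bij_is_inj[OF bij_G[OF g]] by (auto simp: fun_eq_iff indicator_def inj_eq)
  then have "F (indicator {g x}) \<circ> T g = F (indicator {x})"
    using F g by (metis linear_GENEOs_iff)
  then show ?thesis by (metis comp_apply kernel_of_def)
qed

text \<open>Summing over functions instead of orbits avoids choosing representatives: each orbit
  average receives the total weight of its members. As weight and orbit size are constant on an
  orbit, averaging merely redistributes equal terms.\<close>

lemma sum_invariant_weight:
  fixes w :: "('y \<Rightarrow> 'x) \<Rightarrow> real"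
  assumes inv: "\<And>g h. g \<in> G \<Longrightarrow> w (twisted_action T g h) = w h"
  shows "(\<Sum>h\<in>UNIV. w h * orbit_average (orb h) \<phi> y) = (\<Sum>h\<in>UNIV. w h * \<phi> (h y))"
proof -
  have w: "w h = w k" and orb: "orb h = orb k" if "h \<in> orb k" for h k
    using that inv orb_eqI by (auto simp: orbit_def)
  have card: "card (orb k) \<noteq> 0" for k
    using act.orbit_refl[of k] by auto
  have "(\<Sum>h\<in>UNIV. w h * orbit_average (orb h) \<phi> y)
      = (\<Sum>h\<in>UNIV. \<Sum>k | k \<in> UNIV \<and> k \<in> orb h. w h / card (orb h) * \<phi> (k y))"
    by (simp add: orbit_average_apply sum_distrib_left sum_divide_distrib)
  \<comment> \<open>Both sums run over pairs in the same orbit; by symmetry, the functions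
    \<open>h\<close> paired with a fixed \<open>k\<close> form the orbit of
    \<open>k\<close>.\<close>
  also have "\<dots> = (\<Sum>k\<in>UNIV. \<Sum>h | h \<in> UNIV \<and> k \<in> orb h. w h / card (orb h) * \<phi> (k y))"
    by (rule sum.swap_restrict) auto
  also have "\<dots> = (\<Sum>k\<in>UNIV. \<Sum>h\<in>orb k. w k / card (orb k) * \<phi> (k y))"
  proof (intro sum.cong refl)
    fix h k :: "'y \<Rightarrow> 'x"
    show "{h \<in> UNIV. k \<in> orb h} = orb k"
      using act.orbit_sym by auto
    assume "h \<in> orb k"
    then show "w h / card (orb h) * \<phi> (k y) = w k / card (orb k) * \<phi> (k y)"
      using w orb by metis
  qed
  also have "\<dots> = (\<Sum>k\<in>UNIV. w k * \<phi> (k y))"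
    using card by simp
  finally show ?thesis .
qed

lemma stochastic_kernel_in_convex_hull:
  assumes nonneg: "\<And>y x. 0 \<le> a y x"
    and equi: "\<And>g y x. g \<in> G \<Longrightarrow> a (T g y) (g x) = a y x"
    and row: "\<And>y. (\<Sum>x\<in>UNIV. a y x) = 1"
  shows "kernel_op a \<in> convex hull (orbit_average ` twisted_orbits G T)"
proof -
  define w where "w h = (\<Prod>z\<in>UNIV. a z (h z))" for h
  have "w (twisted_action T g h) = w h" if g: "g \<in> G" for g h
  proof -
    \<comment> \<open>Reindexing the rows by the bijection \<open>T g\<close> makes equivariance
      applicable factor by factor.\<close>
    have "w (twisted_action T g h) = (\<Prod>z\<in>UNIV. a (T g z) (twisted_action T g h (T g z)))"
      unfolding w_def
      using prod.reindex_bij_betw[OF bij_T[OF g], of "\<lambda>z. a z (twisted_action T g h z)"] by simp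
    also have "\<dots> = w h"
      using bij_is_inj[OF bij_T[OF g]] by (simp add: w_def twisted_action_eq g equi)
    finally show ?thesis .
  qed
  then have "kernel_op a = (\<Sum>h\<in>UNIV. w h *\<^sub>R orbit_average (orb h))"
    using sum_prod_kernel[of a, OF row]
    by (simp add: fun_eq_iff sum_fun_apply sum_invariant_weight) (simp add: w_def)
  also have "\<dots> \<in> convex hull (orbit_average ` twisted_orbits G T)"
  proof (rule convex_sum)
    \<comment> \<open>The product formula for the constant function 1 computes the total
      weight.\<close>
    show "sum w UNIV = 1"
      using sum_prod_kernel[of a "\<lambda>_. 1", OF row] by (simp add: w_def kernel_op_def row)
    show "0 \<le> w h" for h
      by (simp add: w_def prod_nonneg nonneg)
    show "orbit_average (orb h) \<in> convex hull (orbit_average ` twisted_orbits G T)" for h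
      by (intro hull_inc imageI) (auto simp: twisted_orbits_def orbits_def)
  qed auto
  finally show ?thesis .
qed

end

section \<open>Transitivity, constant row sums and the equality with the convex hull\<close>

locale transitively_twisted = twisted +
  assumes transitive: "\<exists>g\<in>G. T g y = y'"
begin

text \<open>If \<open>T g y = y'\<close>, replacing the summation variable by \<open>g x\<close>
  turns the sum of row \<open>y'\<close> into that of row \<open>y\<close>.\<close>

lemma equivariant_row_sum:
  assumes equi: "\<And>g y x. g \<in> G \<Longrightarrow> a (T g y) (g x) = a y x"
  shows "(\<Sum>x\<in>UNIV. a y x) = (\<Sum>x\<in>UNIV. a y' x :: real)"
proof -
  obtain g where g: "g \<in> G" "T g y = y'" using transitive by blast
  have "(\<Sum>x\<in>UNIV. a y' x) = (\<Sum>x\<in>UNIV. a y' (g x))"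
    using sum.reindex_bij_betw[OF bij_G[OF g(1)], of "a y'"] by simp
  then show ?thesis using equi[OF g(1), of y] g(2) by simp
qed

text \<open>Here \<open>y\<close> is any reference row, as all row sums agree. The scaled form also
  covers the zero kernel, which cannot be normalised.\<close>

lemma nonneg_kernel_in_scaled_hull:
  assumes nonneg: "\<And>y x. 0 \<le> a y x"
    and equi: "\<And>g y x. g \<in> G \<Longrightarrow> a (T g y) (g x) = a y x"
  obtains E where "E \<in> convex hull (orbit_average ` twisted_orbits G T)"
    and "kernel_op a = (\<Sum>x\<in>UNIV. a y x) *\<^sub>R E"
proof (cases "(\<Sum>x\<in>UNIV. a y x) = 0")
  case True
  then have "(\<Sum>x\<in>UNIV. a y' x) = 0" for y'
    using equivariant_row_sum[of a, OF equi] by metis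
  then have "a y' x = 0" for y' x
    by (simp add: sum_nonneg_eq_0_iff nonneg)
  \<comment> \<open>With scaling factor 0 any point of the hull will do; the orbit of an arbitrary
    function supplies one.\<close>
  then have "kernel_op a = (\<Sum>x\<in>UNIV. a y x) *\<^sub>R orbit_average (orb undefined)"
    by (simp add: fun_eq_iff kernel_op_def)
  moreover have "orbit_average (orb undefined) \<in> convex hull (orbit_average ` twisted_orbits G T)"
    by (intro hull_inc imageI) (auto simp: twisted_orbits_def orbits_def)
  ultimately show ?thesis using that by blast
next
  case False
  define s where "s = (\<Sum>x\<in>UNIV. a y x)"
  have "s > 0" using False nonneg by (simp add: s_def order_less_le sum_nonneg)
  have "kernel_op (\<lambda>y x. a y x / s) \<in> convex hull (orbit_average ` twisted_orbits G T)"
  proof (rule stochastic_kernel_in_convex_hull)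
    show "(\<Sum>x\<in>UNIV. a y' x / s) = 1" for y'
      using equivariant_row_sum[of a y' y, OF equi] \<open>s > 0\<close>
      by (simp add: s_def flip: sum_divide_distrib)
  qed (use nonneg equi \<open>s > 0\<close> in auto)
  moreover have "kernel_op a = s *\<^sub>R kernel_op (\<lambda>y x. a y x / s)"
    using \<open>s > 0\<close> by (simp add: fun_eq_iff kernel_op_def sum_distrib_left)
  ultimately show ?thesis using that by (simp add: s_def)
qed

theorem linear_GENEOs_eq_convex_hull:
  "linear_GENEOs G K T = convex hull
     (orbit_average ` twisted_orbits G T \<union> uminus ` orbit_average ` twisted_orbits G T)"
  (is "_ = convex hull (?S \<union> uminus ` ?S)")
proof
  show "convex hull (?S \<union> uminus ` ?S) \<subseteq> linear_GENEOs G K T"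
    by (rule hull_minimal)
      (auto simp: convex_linear_GENEOs orbit_average_GENEO uminus_linear_GENEO)
  show "linear_GENEOs G K T \<subseteq> convex hull (?S \<union> uminus ` ?S)" (is "_ \<subseteq> ?C")
  proof
    fix F assume F: "F \<in> linear_GENEOs G K T"
    then have lin: "linear F" and nonexp: "\<And>\<phi>. unorm (F \<phi>) \<le> unorm \<phi>"
      by (auto simp: linear_GENEOs_iff)
    define p where "p y x = max 0 (kernel_of F y x)" for y x
    define n where "n y x = max 0 (- kernel_of F y x)" for y x
    \<comment> \<open>\<open>undefined\<close> merely names some reference row.\<close>
    define P where "P = (\<Sum>x\<in>UNIV. p undefined x)"
    define N where "N = (\<Sum>x\<in>UNIV. n undefined x)"
    obtain E where E: "E \<in> convex hull ?S" "kernel_op p = P *\<^sub>R E"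
      using nonneg_kernel_in_scaled_hull[of p undefined]
      by (auto simp: p_def P_def kernel_of_equivariant[OF F])
    obtain D where D: "D \<in> convex hull ?S" "kernel_op n = N *\<^sub>R D"
      using nonneg_kernel_in_scaled_hull[of n undefined]
      by (auto simp: n_def N_def kernel_of_equivariant[OF F])
    have "convex hull ?S \<subseteq> ?C" "convex hull (uminus ` ?S) \<subseteq> ?C"
      by (auto intro!: hull_mono)
    moreover have "uminus ` (convex hull ?S) = convex hull (uminus ` ?S)"
      by (rule convex_hull_linear_image) (simp add: linear_uminus)
    ultimately have C: "E \<in> ?C" "- E \<in> ?C" "- D \<in> ?C"
      using E(1) D(1) by auto
    \<comment> \<open>The hull is symmetric, so it contains 0 as the midpoint of \<open>E\<close>
      and \<open>- E\<close>; this point will carry the missing mass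
      \<open>1 - P - N\<close>.\<close>
    have "(1/2) *\<^sub>R E + (1/2) *\<^sub>R (- E) \<in> ?C"
      by (rule convexD[OF convex_convex_hull]) (use C in auto)
    then have 0: "0 \<in> ?C" by simp
    have nonneg: "0 \<le> P" "0 \<le> N"
      by (auto simp: P_def N_def p_def n_def intro!: sum_nonneg)
    \<comment> \<open>Positive and negative parts of an entry add up to its absolute value.\<close>
    have "P + N = (\<Sum>x\<in>UNIV. \<bar>kernel_of F undefined x\<bar>)"
      by (auto simp: P_def N_def p_def n_def simp flip: sum.distrib intro!: sum.cong)
    also have "\<dots> \<le> 1"
      by (rule sum_abs_kernel_of_le_1[OF lin nonexp])
    finally have le: "P + N \<le> 1" .
    have "F = kernel_op (kernel_of F)"
      by (simp add: kernel_op_kernel_of lin)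
    also have "kernel_of F = (\<lambda>y x. p y x - n y x)"
      by (auto simp: p_def n_def fun_eq_iff)
    also have "kernel_op \<dots> = kernel_op p - kernel_op n"
      by (simp add: kernel_op_def fun_eq_iff algebra_simps sum_subtractf)
    also have "\<dots> = P *\<^sub>R E + N *\<^sub>R (- D) + (1 - P - N) *\<^sub>R 0"
      by (simp add: E D)
    also have "\<dots> \<in> ?C"
    proof -
      \<comment> \<open>The lists present the three-term combination as an indexed sum, the shape
        required by \<open>convex_sum\<close>.\<close>
      have "(\<Sum>i\<in>{0::nat,1,2}. [P, N, 1 - P - N] ! i *\<^sub>R [E, - D, 0] ! i) \<in> ?C"
        by (rule convex_sum) (use C 0 nonneg le in \<open>auto simp: convex_convex_hull\<close>)
      then show ?thesis by (simp add: add.assoc)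
    qed
    finally show "F \<in> ?C" .
  qed
qed

end

theorem theorem6p3:
  fixes G :: "('x::finite \<Rightarrow> 'x) set" and K :: "('y::finite \<Rightarrow> 'y) set"
    and T :: "('x \<Rightarrow> 'x) \<Rightarrow> ('y \<Rightarrow> 'y)"
  assumes "subgroup G (BijGroup UNIV)"
    and "subgroup K (BijGroup UNIV)"
    and "T \<in> hom (BijGroup UNIV\<lparr>carrier := G\<rparr>) (BijGroup UNIV\<lparr>carrier := K\<rparr>)"
    and "transitive_action (BijGroup UNIV\<lparr>carrier := T ` G\<rparr>) UNIV (\<lambda>p. p)"
  shows "compactin op_topology (linear_GENEOs G K T) \<and>
    linear_GENEOs G K T = convex hull
      ({(1 / real (card Orb)) *\<^sub>R F_op (measure (orbit_measure Orb)) | Orb. Orb \<in> twisted_orbits G T} \<union>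
       {- ((1 / real (card Orb)) *\<^sub>R F_op (measure (orbit_measure Orb))) | Orb. Orb \<in> twisted_orbits G T}) \<and>
    (\<forall>Orb\<in>twisted_orbits G T. \<forall>\<phi>.
      F_op (measure (orbit_measure Orb)) \<phi> = (\<Sum>h\<in>Orb. \<phi> \<circ> h))"
proof -
  interpret transitively_twisted G K T
  proof (intro transitively_twisted.intro twisted.intro transitively_twisted_axioms.intro)
    \<comment> \<open>A single orbit of the image group means that some \<open>T g\<close> carries
      \<open>y\<close> to \<open>y'\<close>.\<close>
    show "\<exists>g\<in>G. T g y = y'" for y y'
      using transitive_action.unique_orbit[OF assms(4), of y y'] by auto
  qed (fact assms)+
  let ?S = "orbit_average ` twisted_orbits G T"
  have S: "?S \<union> uminus ` ?S
      = {(1 / real (card Orb)) *\<^sub>R F_op (measure (orbit_measure Orb)) | Orb. Orb \<in> twisted_orbits G T} \<union>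
        {- ((1 / real (card Orb)) *\<^sub>R F_op (measure (orbit_measure Orb))) | Orb. Orb \<in> twisted_orbits G T}"
    unfolding orbit_average_def by blast
  have "compactin op_topology (convex hull (?S \<union> uminus ` ?S))"
    by (rule compactin_op_topology_convex_hull)
      (use orbit_average_GENEO uminus_linear_GENEO in \<open>auto simp: linear_GENEOs_def\<close>)
  then show ?thesis
    using linear_GENEOs_eq_convex_hull by (simp only: S) (simp add: F_op_orbit_measure)
qed

end
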